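(* Let $E\subseteq\mathbb{F}_q^d$ be a Sidon set and $p\in[1,\infty]$. Then \[ 2^{-1}q^d\|\widehat E\|_{2p}^2-q^{-d}(\#E)\le\|\widehat{E+E}\|_p\lesssim q^d\|\widehat E\|_{2p}^2. \] In particular, if $\#(E+E)\le c\,q^d$ for some $c\in(0,1)$, then $\|\widehat{E+E}\|_p\approx_c q^d\|\widehat E\|_{2p}^2$ (with implicit constants depending only on $c$).
   Context: $q$ is a prime power, $\chi$ a fixed non-trivial additive character of $\mathbb{F}_q$. For $E\subseteq\mathbb{F}_q^d$, $\widehat E(x)=q^{-d}\sum_{y\in E}\chi(-x\cdot y)$; $\|\widehat E\|_p=\big(q^{-d}\sum_{x\ne0}|\widehat E(x)|^p\big)^{1/p}$ for $p<\infty$, $\|\widehat E\|_\infty=\sup_{x\ne0}|\widehat E(x)|$. $E+E=\{x+y:x,y\in E\}$. Sets are families indexed by $q$; $A\lesssim B$ means $A\le cB$ with $c$ independent of $q$, $A\approx B$ means $A\lesssim B$ and $B\lesssim A$. $E$ is a Sidon set if for $y\in E+E$ the number $g(y)=\#\{(u,v)\in E\times E:u+v=y\}$ satisfies $g(x+x)=1$ for $x\in E$ and $g(x+y)=2$ for distinct $x,y\in E$. *)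

theory Defs
  imports "HOL-Algebra.Ring" "HOL-Library.FuncSet" "HOL-Library.Extended_Real" Complex_Main
begin

text \<open>
  Implicit constants have to be uniform over all finite fields, so fields are elements of
  \<open>'a ring\<close> (which can be quantified over inside a formula) rather than types of class
  \<open>field\<close>. For an infinite type \<open>'a\<close>, such as \<open>nat\<close>, every finite field
  has an isomorphic copy of this form. Vectors over \<open>F\<close> of length \<open>d\<close> are
  extensional functions on \<open>{..<d}\<close>, and \<open>card (carrier F)\<close> plays the role of q.
\<close>

definition vecs :: "'a ring \<Rightarrow> nat \<Rightarrow> (nat \<Rightarrow> 'a) set" where
  "vecs F d = {..<d} \<rightarrow>\<^sub>E carrier F"

definition vzero :: "'a ring \<Rightarrow> nat \<Rightarrow> nat \<Rightarrow> 'a" where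
  "vzero F d = (\<lambda>i\<in>{..<d}. \<zero>\<^bsub>F\<^esub>)"

definition vadd :: "'a ring \<Rightarrow> nat \<Rightarrow> (nat \<Rightarrow> 'a) \<Rightarrow> (nat \<Rightarrow> 'a) \<Rightarrow> nat \<Rightarrow> 'a" where
  "vadd F d x y = (\<lambda>i\<in>{..<d}. x i \<oplus>\<^bsub>F\<^esub> y i)"

definition vdot :: "'a ring \<Rightarrow> nat \<Rightarrow> (nat \<Rightarrow> 'a) \<Rightarrow> (nat \<Rightarrow> 'a) \<Rightarrow> 'a" where
  "vdot F d x y = (\<Oplus>\<^bsub>F\<^esub>i\<in>{..<d}. x i \<otimes>\<^bsub>F\<^esub> y i)"

definition sumset :: "'a ring \<Rightarrow> nat \<Rightarrow> (nat \<Rightarrow> 'a) set \<Rightarrow> (nat \<Rightarrow> 'a) set" where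
  "sumset F d E = {vadd F d x y | x y. x \<in> E \<and> y \<in> E}"

definition nontrivial_additive_character :: "'a ring \<Rightarrow> ('a \<Rightarrow> complex) \<Rightarrow> bool" where
  "nontrivial_additive_character F \<chi> \<longleftrightarrow>
     (\<forall>a\<in>carrier F. cmod (\<chi> a) = 1) \<and>
     (\<forall>a\<in>carrier F. \<forall>b\<in>carrier F. \<chi> (a \<oplus>\<^bsub>F\<^esub> b) = \<chi> a * \<chi> b) \<and>
     (\<exists>a\<in>carrier F. \<chi> a \<noteq> 1)"

definition fourier ::
  "'a ring \<Rightarrow> nat \<Rightarrow> ('a \<Rightarrow> complex) \<Rightarrow> (nat \<Rightarrow> 'a) set \<Rightarrow> (nat \<Rightarrow> 'a) \<Rightarrow> complex" where
  "fourier F d \<chi> E x = (\<Sum>y\<in>E. \<chi> (\<ominus>\<^bsub>F\<^esub> (vdot F d x y))) / of_nat (card (carrier F) ^ d)"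

text \<open>The zero frequency is excluded, while the normalisation is still by \<open>q ^ d\<close>.\<close>

definition lp_norm :: "'a ring \<Rightarrow> nat \<Rightarrow> ereal \<Rightarrow> ((nat \<Rightarrow> 'a) \<Rightarrow> complex) \<Rightarrow> real" where
  "lp_norm F d p f =
     (if p = \<infinity> then (SUP x\<in>vecs F d - {vzero F d}. cmod (f x))
      else ((\<Sum>x\<in>vecs F d - {vzero F d}. cmod (f x) powr real_of_ereal p) / real (card (carrier F) ^ d))
             powr (1 / real_of_ereal p))"

definition rep_count :: "'a ring \<Rightarrow> nat \<Rightarrow> (nat \<Rightarrow> 'a) set \<Rightarrow> (nat \<Rightarrow> 'a) \<Rightarrow> nat" where
  "rep_count F d E y = card {(u, v). u \<in> E \<and> v \<in> E \<and> vadd F d u v = y}"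

definition sidon_set :: "'a ring \<Rightarrow> nat \<Rightarrow> (nat \<Rightarrow> 'a) set \<Rightarrow> bool" where
  "sidon_set F d E \<longleftrightarrow>
     E \<subseteq> vecs F d \<and>
     (\<forall>x\<in>E. rep_count F d E (vadd F d x x) = 1) \<and>
     (\<forall>x\<in>E. \<forall>y\<in>E. x \<noteq> y \<longrightarrow> rep_count F d E (vadd F d x y) = 2)"

definition finite_field_setting :: "'a ring \<Rightarrow> nat \<Rightarrow> ('a \<Rightarrow> complex) \<Rightarrow> bool" where
  "finite_field_setting F d \<chi> \<longleftrightarrow>
     field F \<and> finite (carrier F) \<and> d \<ge> 1 \<and> nontrivial_additive_character F \<chi>"

end

theory Submission imports Defs "HOL-Analysis.Convex" begin

text \<open>
  Write \<open>N = q ^ d\<close>, \<open>f\<close> for the Fourier transform of \<open>E\<close> and \<open>a\<close> for its norm of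
  exponent \<open>2p\<close>. In a Sidon set every sum of two distinct elements has two representations and
  every double has one, so the transform \<open>g\<close> of \<open>E + E\<close> satisfies
  \<open>2 g(x) = N f(x)^2 + f(2x)\<close>. The first term on the right has norm \<open>N a^2\<close>, and the second
  has the norm of \<open>f\<close>, which is at most \<open>#E / N\<close> and, by the power mean inequality, at most
  \<open>a\<close>. Minkowski's inequality then gives the first lower bound.

  Plancherel together with \<open>(#E)^2 + #E = 2 #(E + E) \<le> 2 N\<close> gives \<open>(N a)^2 \<ge> 1/2\<close> for
  nonempty \<open>E\<close>, so \<open>a\<close> is absorbed into \<open>N a^2\<close> and the upper bound follows. For
  the reverse estimate, \<open>a\<close> is again absorbed into \<open>N a^2\<close> if \<open>N a \<ge> 2\<close>; otherwise \<open>N a^2 \<le> 4 / N\<close>,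
  while Plancherel and \<open>|g| \<le> #(E + E) / N\<close> show that the norm of \<open>g\<close> of exponent 1 is at
  least \<open>(1 - c) / N\<close>.
\<close>

section \<open>Inequalities for finite power sums\<close>

text \<open>For positive arguments this is convexity of the power function. If one argument
  vanishes, what remains is \<open>s powr r\<close> \<le> \<open>s\<close> for weights
  \<open>s\<close> in [0,1].\<close>

lemma powr_convex_combination:
  fixes x y t r :: real
  assumes "1 \<le> r" "0 \<le> x" "0 \<le> y" "0 \<le> t" "t \<le> 1"
  shows "((1 - t) * x + t * y) powr r \<le> (1 - t) * x powr r + t * y powr r"
proof -
  have shrink: "(s * z) powr r \<le> s * z powr r" if "0 \<le> s" "s \<le> 1" for s z :: real
  proof (cases "s = 0")
    case False
    then have "s powr r \<le> s powr 1"
      using that assms(1) by (intro powr_mono') auto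
    then show ?thesis
      using that by (simp add: powr_mult mult_right_mono)
  qed simp
  consider "x = 0" | "y = 0" | "0 < x" "0 < y"
    using assms by linarith
  then show ?thesis
  proof cases
    case 1
    then show ?thesis using shrink[of t y] assms by simp
  next
    case 2
    then show ?thesis using shrink[of "1 - t" x] assms by simp
  next
    case 3
    then show ?thesis
      using convex_onD[OF powr_convex[OF assms(1)], of t x y] assms by simp
  qed
qed

text \<open>Normalise by the two norms \<open>a\<close> and \<open>b\<close>: then
  \<open>f + g\<close> is \<open>a + b\<close> times a convex combination of \<open>f / a\<close>
  and \<open>g / b\<close>, with weights \<open>a / (a + b)\<close> and \<open>b / (a + b)\<close>.
  Pointwise convexity is summed, and each normalised power sum equals 1. A vanishing norm forces its
  function to vanish.\<close>

lemma Minkowski_inequality_sum: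
  fixes f g :: "'b \<Rightarrow> real"
  assumes "finite A" and r: "1 \<le> r"
    and f: "\<And>x. x \<in> A \<Longrightarrow> 0 \<le> f x" and g: "\<And>x. x \<in> A \<Longrightarrow> 0 \<le> g x"
  shows "(\<Sum>x\<in>A. (f x + g x) powr r) powr (1 / r)
         \<le> (\<Sum>x\<in>A. f x powr r) powr (1 / r) + (\<Sum>x\<in>A. g x powr r) powr (1 / r)"
proof -
  define a where "a = (\<Sum>x\<in>A. f x powr r) powr (1 / r)"
  define b where "b = (\<Sum>x\<in>A. g x powr r) powr (1 / r)"
  have a0: "a \<ge> 0" and b0: "b \<ge> 0" by (auto simp: a_def b_def)
  have ar: "a powr r = (\<Sum>x\<in>A. f x powr r)" and br: "b powr r = (\<Sum>x\<in>A. g x powr r)"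
    using r by (auto simp: a_def b_def powr_powr sum_nonneg)
  consider "a = 0" | "b = 0" | "0 < a" "0 < b" using a0 b0 by linarith
  then show ?thesis
  proof cases
    case 1
    then have "\<forall>x\<in>A. f x = 0"
      using ar assms(1) by (simp add: sum_nonneg_eq_0_iff)
    then show ?thesis by simp
  next
    case 2
    then have "\<forall>x\<in>A. g x = 0"
      using br assms(1) by (simp add: sum_nonneg_eq_0_iff)
    then show ?thesis by simp
  next
    case 3
    define t where "t = b / (a + b)"
    have t: "0 \<le> t" "t \<le> 1" "1 - t = a / (a + b)"
      using 3 by (auto simp: t_def field_simps)
    have pt: "(f x + g x) powr r \<le>
       (a + b) powr r * ((1 - t) * (f x powr r / a powr r) + t * (g x powr r / b powr r))"
      if "x \<in> A" for x
    proof -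
      have "f x + g x = (a + b) * ((1 - t) * (f x / a) + t * (g x / b))"
        using 3 unfolding t(3) by (simp add: t_def add_divide_distrib[symmetric])
      then have "(f x + g x) powr r = (a + b) powr r * ((1 - t) * (f x / a) + t * (g x / b)) powr r"
        by (simp add: powr_mult)
      also have "\<dots> \<le> (a + b) powr r * ((1 - t) * (f x / a) powr r + t * (g x / b) powr r)"
        using 3 t f[OF that] g[OF that] r
        by (intro mult_left_mono powr_convex_combination) auto
      finally show ?thesis by (simp add: powr_divide)
    qed
    have "(\<Sum>x\<in>A. (f x + g x) powr r) \<le>
       (\<Sum>x\<in>A. (a + b) powr r * ((1 - t) * (f x powr r / a powr r) + t * (g x powr r / b powr r)))"
      by (rule sum_mono) (rule pt)
    also have "\<dots> = (a + b) powr r * ((1 - t) * ((\<Sum>x\<in>A. f x powr r) / a powr r)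
                                    + t * ((\<Sum>x\<in>A. g x powr r) / b powr r))"
      by (simp only: sum_distrib_left[symmetric] sum.distrib sum_divide_distrib[symmetric])
    also have "\<dots> = (a + b) powr r"
      using 3 by (simp flip: ar br)
    finally have "(\<Sum>x\<in>A. (f x + g x) powr r) powr (1 / r) \<le> ((a + b) powr r) powr (1 / r)"
      using r by (intro powr_mono2) (auto intro: sum_nonneg)
    also have "\<dots> = a + b"
      using r a0 b0 by (simp add: powr_powr)
    finally show ?thesis by (simp add: a_def b_def)
  qed
qed

text \<open>The concave function \<open>t powr s\<close> lies below its tangent at 1; for positive
  \<open>t\<close> this is convexity of \<open>exp\<close> between 0 and
  \<open>ln t\<close>.\<close>

lemma powr_le_tangent:
  fixes t s :: real
  assumes "0 \<le> t" "0 < s" "s \<le> 1"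
  shows "t powr s \<le> 1 - s + s * t"
proof (cases "t = 0")
  case False
  then show ?thesis
    using convex_onD[OF exp_convex, of s 0 "ln t"] assms by (simp add: powr_def)
qed (use assms in auto)

text \<open>Divide by the right-hand mean \<open>b\<close> and apply the tangent bound with exponent
  \<open>r / s\<close> to \<open>(f x / b) powr s\<close>. The divisor \<open>N\<close> may exceed
  \<open>card A\<close>, to fit norms that omit one frequency but still divide by the full
  count.\<close>

lemma power_mean_mono:
  fixes f :: "'b \<Rightarrow> real"
  assumes "finite A" and N: "real (card A) \<le> N" "0 < N"
    and rs: "0 < r" "r \<le> s" and f: "\<And>x. x \<in> A \<Longrightarrow> 0 \<le> f x"
  shows "((\<Sum>x\<in>A. f x powr r) / N) powr (1 / r) \<le> ((\<Sum>x\<in>A. f x powr s) / N) powr (1 / s)"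
proof -
  define b where "b = ((\<Sum>x\<in>A. f x powr s) / N) powr (1 / s)"
  have b0: "0 \<le> b" by (simp add: b_def)
  have bs: "N * b powr s = (\<Sum>x\<in>A. f x powr s)"
    using N rs by (simp add: b_def powr_powr sum_nonneg)
  show ?thesis
  proof (cases "b = 0")
    case True
    then have "\<forall>x\<in>A. f x = 0"
      using bs assms(1) by (simp add: sum_nonneg_eq_0_iff)
    then show ?thesis by simp
  next
    case False
    define u where "u = r / s"
    have u: "0 < u" "u \<le> 1" using rs by (auto simp: u_def)
    have pt: "f x powr r \<le> b powr r * (1 - u + u * (f x powr s / b powr s))" if "x \<in> A" for x
    proof -
      have "f x powr r = b powr r * ((f x / b) powr s) powr u"
        using False rs by (simp add: powr_powr u_def powr_divide)
      also have "\<dots> \<le> b powr r * (1 - u + u * (f x / b) powr s)"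
        using u by (intro mult_left_mono powr_le_tangent) auto
      finally show ?thesis by (simp add: powr_divide)
    qed
    have "(\<Sum>x\<in>A. f x powr r) \<le> (\<Sum>x\<in>A. b powr r * (1 - u + u * (f x powr s / b powr s)))"
      by (rule sum_mono) (rule pt)
    also have "\<dots> = b powr r * (real (card A) * (1 - u) + u * ((\<Sum>x\<in>A. f x powr s) / b powr s))"
      by (simp only: sum_distrib_left[symmetric] sum.distrib sum_divide_distrib[symmetric] sum_constant)
    also have "\<dots> = b powr r * (real (card A) * (1 - u) + u * N)"
      using False by (simp flip: bs)
    \<comment> \<open>The weights have total mass \<open>card A / N\<close>, at most 1; since
      \<open>1 - u\<close> is nonnegative, raising the count to \<open>N\<close> only enlarges the
      bound.\<close>
    also have "\<dots> \<le> b powr r * (N * (1 - u) + u * N)"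
      using u N by (intro mult_left_mono add_right_mono mult_right_mono) auto
    also have "\<dots> = b powr r * N" by (simp add: algebra_simps)
    finally have "(\<Sum>x\<in>A. f x powr r) / N \<le> b powr r"
      using N by (simp add: field_simps)
    then have "((\<Sum>x\<in>A. f x powr r) / N) powr (1 / r) \<le> (b powr r) powr (1 / r)"
      using rs N by (intro powr_mono2) (auto intro!: sum_nonneg divide_nonneg_nonneg)
    also have "\<dots> = b" using rs b0 by (simp add: powr_powr)
    finally show ?thesis by (simp add: b_def)
  qed
qed

section \<open>Characters and the Plancherel identity\<close>

text \<open>Fixing one field, dimension and character does not endanger uniformity, because the norm
  estimates proved here carry explicit constants.\<close>

locale finite_field_fourier =
  fixes F :: "'a ring" (structure) and d :: nat and \<chi> :: "'a \<Rightarrow> complex"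
  assumes setting: "finite_field_setting F d \<chi>"
begin

sublocale field F
  using setting by (simp add: finite_field_setting_def)

abbreviation N :: real where "N \<equiv> real (card (carrier F)) ^ d"

abbreviation V where "V \<equiv> vecs F d"

abbreviation dual where "dual \<equiv> V - {vzero F d}"

text \<open>The kernel of the transform without its factor \<open>1 / N\<close>, so that counting
  identities can be stated for plain exponential sums.\<close>

definition wave :: "(nat \<Rightarrow> 'a) \<Rightarrow> (nat \<Rightarrow> 'a) \<Rightarrow> complex" where
  "wave x y = \<chi> (\<ominus> (vdot F d x y))"

lemma finite_carrier: "finite (carrier F)"
  and d_pos: "0 < d"
  and \<chi>_norm: "a \<in> carrier F \<Longrightarrow> cmod (\<chi> a) = 1"
  and \<chi>_add: "a \<in> carrier F \<Longrightarrow> b \<in> carrier F \<Longrightarrow> \<chi> (a \<oplus> b) = \<chi> a * \<chi> b"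
  and \<chi>_nontrivial: "\<exists>a\<in>carrier F. \<chi> a \<noteq> 1"
  using setting by (auto simp: finite_field_setting_def nontrivial_additive_character_def)

lemma finite_V [simp]: "finite V"
  by (simp add: vecs_def finite_PiE finite_carrier)

lemma card_V: "real (card V) = N"
  by (simp add: vecs_def card_PiE)

lemma card_carrier_ge_2: "2 \<le> card (carrier F)"
proof -
  have "card {\<zero>, \<one>} \<le> card (carrier F)"
    by (intro card_mono finite_carrier) auto
  then show ?thesis by simp
qed

lemma N_ge_2: "2 \<le> N"
proof -
  have "(2::real) ^ 1 \<le> 2 ^ d" using d_pos by (intro power_increasing) auto
  also have "\<dots> \<le> N" using card_carrier_ge_2 by (intro power_mono) auto
  finally show ?thesis by simp
qed

lemma N_pos: "0 < N" and N_nonzero: "N \<noteq> 0"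
  using N_ge_2 by linarith+

lemma V_closed: "x \<in> V \<Longrightarrow> i < d \<Longrightarrow> x i \<in> carrier F"
  by (auto simp: vecs_def)

lemma vzero_closed [simp]: "vzero F d \<in> V"
  by (auto simp: vecs_def vzero_def)

lemma vadd_closed [simp]: "x \<in> V \<Longrightarrow> y \<in> V \<Longrightarrow> vadd F d x y \<in> V"
  by (auto simp: vecs_def vadd_def PiE_iff)

lemma V_eqI: "x \<in> V \<Longrightarrow> y \<in> V \<Longrightarrow> (\<And>i. i < d \<Longrightarrow> x i = y i) \<Longrightarrow> x = y"
  unfolding vecs_def by (rule PiE_ext) auto

lemma card_dual: "real (card dual) = N - 1"
proof -
  have "card V = Suc (card dual)" by (rule card.remove) auto
  then show ?thesis using card_V by linarith
qed

lemma dual_nonempty: "dual \<noteq> {}"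
proof
  assume "dual = {}"
  then have "real (card dual) = 0" by (simp only: card.empty of_nat_0)
  then show False using card_dual N_ge_2 by linarith
qed

lemma vadd_cancel_left:
  assumes "w \<in> V" "x \<in> V" "y \<in> V" "vadd F d w x = vadd F d w y"
  shows "x = y"
proof (rule V_eqI)
  fix i assume "i < d"
  then show "x i = y i"
    using fun_cong[OF assms(4), of i] assms(1-3) add.right_cancel[of "w i" "x i" "y i"]
    by (simp add: vadd_def V_closed a_comm)
qed (use assms in auto)

lemma bij_betw_translation:
  assumes "w \<in> V"
  shows "bij_betw (vadd F d w) V V"
proof -
  have inj: "inj_on (vadd F d w) V"
    using assms vadd_cancel_left by (intro inj_onI)
  have "vadd F d w ` V \<subseteq> V" using assms by auto
  then show ?thesis
    using endo_inj_surj[OF finite_V _ inj] inj by (simp add: bij_betw_def)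
qed

section \<open>The pairing of vectors and the waves it defines\<close>

lemma vdot_closed [simp]: "x \<in> V \<Longrightarrow> y \<in> V \<Longrightarrow> vdot F d x y \<in> carrier F"
  unfolding vdot_def by (intro finsum_closed) (auto simp: V_closed)

lemma vdot_add_left:
  assumes "x \<in> V" "y \<in> V" "z \<in> V"
  shows "vdot F d (vadd F d x y) z = vdot F d x z \<oplus> vdot F d y z"
proof -
  have "vdot F d (vadd F d x y) z = (\<Oplus>i\<in>{..<d}. x i \<otimes> z i \<oplus> y i \<otimes> z i)"
    unfolding vdot_def
    using assms by (intro finsum_cong') (auto simp: vadd_def V_closed l_distr)
  also have "\<dots> = vdot F d x z \<oplus> vdot F d y z"
    unfolding vdot_def using assms by (intro finsum_addf) (auto simp: V_closed)
  finally show ?thesis .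
qed

lemma vdot_commute:
  assumes "x \<in> V" "y \<in> V"
  shows "vdot F d x y = vdot F d y x"
  unfolding vdot_def using assms by (intro finsum_cong') (auto simp: V_closed m_comm)

lemma \<chi>_zero: "\<chi> \<zero> = 1"
proof -
  have "\<chi> \<zero> * \<chi> \<zero> = \<chi> \<zero>" using \<chi>_add[of \<zero> \<zero>] by (simp only: l_zero zero_closed)
  moreover have "\<chi> \<zero> \<noteq> 0" using \<chi>_norm[of \<zero>] by (metis norm_zero zero_closed zero_neq_one)
  ultimately show ?thesis by simp
qed

lemma wave_norm [simp]: "x \<in> V \<Longrightarrow> y \<in> V \<Longrightarrow> cmod (wave x y) = 1"
  by (simp add: wave_def \<chi>_norm)

lemma norm_wave_sum_le:
  assumes "x \<in> V" "A \<subseteq> V"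
  shows "cmod (\<Sum>y\<in>A. wave x y) \<le> real (card A)"
proof -
  have "cmod (\<Sum>y\<in>A. wave x y) \<le> (\<Sum>y\<in>A. cmod (wave x y))" by (rule norm_sum)
  also have "\<dots> = (\<Sum>y\<in>A. 1)" using assms by (intro sum.cong refl wave_norm) auto
  finally show ?thesis by simp
qed

lemma wave_add_left:
  "x \<in> V \<Longrightarrow> y \<in> V \<Longrightarrow> z \<in> V \<Longrightarrow> wave (vadd F d x y) z = wave x z * wave y z"
  by (simp add: wave_def vdot_add_left minus_add \<chi>_add)

lemma wave_commute: "x \<in> V \<Longrightarrow> y \<in> V \<Longrightarrow> wave x y = wave y x"
  by (simp add: wave_def vdot_commute)

lemma wave_add_right:
  "x \<in> V \<Longrightarrow> y \<in> V \<Longrightarrow> z \<in> V \<Longrightarrow> wave x (vadd F d y z) = wave x y * wave x z"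
  using wave_add_left[of y z x] by (simp add: wave_commute)

lemma wave_zero_left:
  assumes "y \<in> V"
  shows "wave (vzero F d) y = 1"
proof -
  have "vdot F d (vzero F d) y = (\<Oplus>i\<in>{..<d}. \<zero>)"
    unfolding vdot_def using assms by (intro finsum_cong') (auto simp: vzero_def V_closed)
  then show ?thesis by (simp add: wave_def \<chi>_zero)
qed

text \<open>At a coordinate where \<open>y\<close> and \<open>z\<close> differ, place the scalar
  \<open>b\<close> for which the pairing with \<open>z - y\<close> is a given \<open>a\<close> with
  \<open>\<chi> a\<close> \<noteq> 1. The two waves then differ by the factor
  \<open>\<chi> a\<close>.\<close>

lemma wave_separates:
  assumes y: "y \<in> V" and z: "z \<in> V" and "y \<noteq> z"
  shows "\<exists>w\<in>V. wave w y \<noteq> wave w z"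
proof -
  obtain i where i: "i < d" "y i \<noteq> z i" using V_eqI assms by blast
  obtain a where a: "a \<in> carrier F" "\<chi> a \<noteq> 1" using \<chi>_nontrivial by blast
  have yi: "y i \<in> carrier F" and zi: "z i \<in> carrier F" using V_closed i y z by auto
  define c where "c = z i \<ominus> y i"
  have c: "c \<in> carrier F" "c \<noteq> \<zero>"
    using yi zi i by (auto simp: c_def minus_eq dest: minus_equality)
  define b where "b = a \<otimes> inv c"
  have b: "b \<in> carrier F" and bc: "b \<otimes> c = a"
    using a c by (auto simp: b_def m_assoc field_Units)
  define w where "w = (\<lambda>j\<in>{..<d}. if j = i then b else \<zero>)"
  have w: "w \<in> V" using b by (auto simp: w_def vecs_def)
  have dot: "vdot F d w v = b \<otimes> v i" if "v \<in> V" for v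
  proof -
    have "vdot F d w v = (\<Oplus>j\<in>{..<d}. if i = j then b \<otimes> v j else \<zero>)"
      unfolding vdot_def using that b
      by (intro finsum_cong') (auto simp: w_def V_closed)
    also have "\<dots> = b \<otimes> v i"
      using that b i by (intro finsum_singleton) (auto simp: V_closed)
    finally show ?thesis .
  qed
  have "a \<oplus> \<ominus> (b \<otimes> z i) = \<ominus> (b \<otimes> y i)"
  proof -
    have "a = \<ominus> (b \<otimes> y i) \<oplus> b \<otimes> z i"
      using b yi zi unfolding bc[symmetric] c_def minus_eq by (simp add: r_distr r_minus a_comm)
    then show ?thesis using b yi zi by (simp add: a_assoc r_neg)
  qed
  then have "wave w y = \<chi> a * wave w z"
    using \<chi>_add[of a "\<ominus> (b \<otimes> z i)"] a b zi by (simp add: wave_def dot y z)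
  moreover have "wave w z \<noteq> 0" using wave_norm[OF w z] by auto
  ultimately have "wave w y \<noteq> wave w z" using a by simp
  then show ?thesis using w by blast
qed

text \<open>Translating the summation variable by a separating frequency \<open>w\<close> multiplies
  the sum by \<open>wave w y * cnj (wave w z)\<close>. This factor is not 1, so the sum
  vanishes.\<close>

lemma wave_orthogonality:
  assumes y: "y \<in> V" and z: "z \<in> V"
  shows "(\<Sum>x\<in>V. wave x y * cnj (wave x z)) = (if y = z then of_real N else 0)"
proof (cases "y = z")
  case True
  have "(\<Sum>x\<in>V. wave x y * cnj (wave x z)) = (\<Sum>x\<in>V. 1)"
    using True y by (intro sum.cong refl) (simp add: complex_norm_square[symmetric])
  then show ?thesis using True by (simp flip: card_V)
next
  case False
  obtain w where w: "w \<in> V" "wave w y \<noteq> wave w z"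
    using wave_separates[OF y z False] by blast
  let ?S = "\<Sum>x\<in>V. wave x y * cnj (wave x z)"
  have "?S = (\<Sum>x\<in>V. wave (vadd F d w x) y * cnj (wave (vadd F d w x) z))"
    by (rule sum.reindex_bij_betw[OF bij_betw_translation[OF w(1)], symmetric])
  also have "\<dots> = (wave w y * cnj (wave w z)) * ?S"
    unfolding sum_distrib_left
    by (intro sum.cong refl) (simp add: wave_add_left w y z)
  finally have eq: "?S = (wave w y * cnj (wave w z)) * ?S" .
  have "wave w y * cnj (wave w z) \<noteq> 1"
  proof
    assume "wave w y * cnj (wave w z) = 1"
    then have "wave w y * (cnj (wave w z) * wave w z) = wave w z"
      by (metis mult.assoc mult_1)
    moreover have "cnj (wave w z) * wave w z = 1"
      using complex_norm_square[of "wave w z"] w z by (simp add: mult.commute)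
    ultimately show False using w(2) by simp
  qed
  moreover have "(1 - wave w y * cnj (wave w z)) * ?S = 0"
    using eq by (simp only: left_diff_distrib mult_1_left right_minus_eq)
  ultimately have "?S = 0" by simp
  then show ?thesis using False by simp
qed

section \<open>Exponential sums and their mean squares\<close>

lemma fourier_eq: "fourier F d \<chi> A x = (\<Sum>y\<in>A. wave x y) / of_real N"
  by (simp add: fourier_def wave_def)

text \<open>Expand the square and sum over the frequency first; orthogonality leaves only the
  diagonal pairs, each contributing \<open>N\<close>.\<close>

lemma Plancherel:
  assumes "A \<subseteq> V"
  shows "(\<Sum>x\<in>V. (cmod (\<Sum>y\<in>A. wave x y))\<^sup>2) = N * real (card A)"
proof -
  have fin: "finite A" using assms finite_V by (rule finite_subset)
  have "complex_of_real (\<Sum>x\<in>V. (cmod (\<Sum>y\<in>A. wave x y))\<^sup>2)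
      = (\<Sum>x\<in>V. \<Sum>y\<in>A. \<Sum>z\<in>A. wave x y * cnj (wave x z))"
    by (simp add: complex_norm_square sum_product flip: of_real_power)
  also have "\<dots> = (\<Sum>y\<in>A. \<Sum>z\<in>A. \<Sum>x\<in>V. wave x y * cnj (wave x z))"
    by (subst sum.swap) (intro sum.cong refl sum.swap)
  also have "\<dots> = (\<Sum>y\<in>A. \<Sum>z\<in>A. if y = z then of_real N else 0)"
    using assms by (intro sum.cong refl wave_orthogonality) auto
  also have "\<dots> = of_real (N * real (card A))"
    using fin by (simp add: mult.commute)
  finally show ?thesis using of_real_eq_iff by blast
qed

lemma Plancherel_dual:
  assumes "A \<subseteq> V"
  shows "(\<Sum>x\<in>dual. (cmod (\<Sum>y\<in>A. wave x y))\<^sup>2) = N * real (card A) - (real (card A))\<^sup>2"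
proof -
  \<comment> \<open>At frequency zero the exponential sum is \<open>card A\<close>, whose square is
    the term subtracted.\<close>
  have "(\<Sum>y\<in>A. wave (vzero F d) y) = (\<Sum>y\<in>A. 1)"
    using assms by (intro sum.cong refl wave_zero_left) auto
  then show ?thesis
    using sum.remove[OF finite_V vzero_closed, of "\<lambda>x. (cmod (\<Sum>y\<in>A. wave x y))\<^sup>2"]
      Plancherel[OF assms] by simp
qed

section \<open>The norms on nonzero frequencies\<close>

lemma lp_norm_ereal:
  "lp_norm F d (ereal r) f = ((\<Sum>x\<in>dual. cmod (f x) powr r) / N) powr (1 / r)"
  by (simp add: lp_norm_def)

text \<open>There is a nonzero frequency because \<open>N\<close> is at least 2, so the real-valued
  supremum runs over a finite nonempty set and is a maximum.\<close>

lemma lp_norm_infinity: "lp_norm F d \<infinity> f = Max ((\<lambda>x. cmod (f x)) ` dual)"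
  using dual_nonempty by (simp add: lp_norm_def cSup_eq_Max)

lemma exponent_cases:
  assumes "1 \<le> (p::ereal)"
  obtains r where "p = ereal r" "1 \<le> r" | "p = \<infinity>"
  using assms by (cases p) (auto simp: one_ereal_def)

lemma lp_norm_nonneg: "1 \<le> p \<Longrightarrow> 0 \<le> lp_norm F d p f"
proof (erule exponent_cases)
  assume "p = \<infinity>"
  moreover obtain x where "x \<in> dual" using dual_nonempty by blast
  then have "cmod (f x) \<le> Max ((\<lambda>x. cmod (f x)) ` dual)" by (intro Max_ge) auto
  then have "0 \<le> Max ((\<lambda>x. cmod (f x)) ` dual)" using norm_ge_zero order_trans by blast
  ultimately show ?thesis by (simp add: lp_norm_infinity)
qed (simp add: lp_norm_ereal)

lemma lp_norm_cong:
  "(\<And>x. x \<in> dual \<Longrightarrow> cmod (f x) = cmod (g x)) \<Longrightarrow> lp_norm F d p f = lp_norm F d p g"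
  unfolding lp_norm_def by (intro if_cong refl arg_cong2[where f = "(powr)"]
    arg_cong2[where f = "(/)"] SUP_cong sum.cong) auto

lemma lp_norm_triangle:
  assumes "1 \<le> p"
  shows "lp_norm F d p (\<lambda>x. f x + g x) \<le> lp_norm F d p f + lp_norm F d p g"
  using assms
proof (cases rule: exponent_cases)
  case (1 r)
  have "(\<Sum>x\<in>dual. cmod (f x + g x) powr r) powr (1 / r)
      \<le> (\<Sum>x\<in>dual. (cmod (f x) + cmod (g x)) powr r) powr (1 / r)"
    using 1(2) by (intro powr_mono2 sum_mono sum_nonneg norm_triangle_ineq) auto
  also have "\<dots> \<le> (\<Sum>x\<in>dual. cmod (f x) powr r) powr (1 / r)
                 + (\<Sum>x\<in>dual. cmod (g x) powr r) powr (1 / r)"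
    using 1(2) by (intro Minkowski_inequality_sum) auto
  finally show ?thesis
    unfolding 1(1) lp_norm_ereal powr_divide add_divide_distrib[symmetric]
    by (intro divide_right_mono) auto
next
  case 2
  have "cmod (f x + g x) \<le> Max ((\<lambda>x. cmod (f x)) ` dual) + Max ((\<lambda>x. cmod (g x)) ` dual)"
    if "x \<in> dual" for x
    using that by (intro order_trans[OF norm_triangle_ineq] add_mono Max_ge) auto
  then show ?thesis
    unfolding 2 lp_norm_infinity using dual_nonempty by (subst Max_le_iff) auto
qed

lemma lp_norm_reindex:
  assumes "bij_betw h dual dual"
  shows "lp_norm F d p (\<lambda>x. f (h x)) = lp_norm F d p f"
proof -
  have "(\<Sum>x\<in>dual. cmod (f (h x)) powr s) = (\<Sum>x\<in>dual. cmod (f x) powr s)" for s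
    by (rule sum.reindex_bij_betw[OF assms])
  moreover have "(\<lambda>x. cmod (f (h x))) ` dual = (\<lambda>x. cmod (f x)) ` dual"
    using bij_betw_imp_surj_on[OF assms] by (metis (no_types) image_image)
  ultimately show ?thesis unfolding lp_norm_def by presburger
qed

text \<open>The norm averages over \<open>N - 1\<close> points of weight \<open>1 / N\<close>, a
  total mass below 1, so power means increase with the exponent. For the infinite exponent every
  term is bounded by the maximum.\<close>

lemma lp_norm_exponent_mono:
  assumes "1 \<le> p" "p \<le> s"
  shows "lp_norm F d p f \<le> lp_norm F d s f"
  using assms(1)
proof (cases rule: exponent_cases)
  case p: (1 r)
  have "1 \<le> s" using assms by (rule order_trans)
  then show ?thesis
  proof (cases rule: exponent_cases)
    case (1 r')
    then show ?thesis
      using assms(2) p N_pos card_dual unfolding p(1) 1(1) lp_norm_ereal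
      by (intro power_mean_mono) auto
  next
    case 2
    define M where "M = Max ((\<lambda>x. cmod (f x)) ` dual)"
    have M: "cmod (f x) \<le> M" if "x \<in> dual" for x
      using that unfolding M_def by (intro Max_ge) auto
    have M0: "0 \<le> M" using lp_norm_nonneg[of \<infinity> f] by (simp add: M_def lp_norm_infinity)
    have "(\<Sum>x\<in>dual. cmod (f x) powr r) \<le> (\<Sum>x\<in>dual. M powr r)"
      using M p(2) by (intro sum_mono powr_mono2) auto
    also have "\<dots> = (N - 1) * M powr r" by (simp only: sum_constant card_dual)
    also have "\<dots> \<le> N * M powr r" by (intro mult_right_mono) auto
    finally have "((\<Sum>x\<in>dual. cmod (f x) powr r) / N) powr (1 / r) \<le> (M powr r) powr (1 / r)"
      using N_pos p(2)
      by (intro powr_mono2) (auto simp: field_simps intro!: divide_nonneg_nonneg sum_nonneg)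
    also have "\<dots> = M" using p(2) M0 by (simp add: powr_powr)
    finally show ?thesis unfolding p(1) 2 lp_norm_ereal lp_norm_infinity M_def .
  qed
next
  case 2
  then show ?thesis using assms by simp
qed

lemma lp_norm_scale:
  assumes "1 \<le> p"
  shows "lp_norm F d p (\<lambda>x. c * f x) = cmod c * lp_norm F d p f"
  using assms
proof (cases rule: exponent_cases)
  case (1 r)
  have "(\<Sum>x\<in>dual. cmod (c * f x) powr r) / N = cmod c powr r * ((\<Sum>x\<in>dual. cmod (f x) powr r) / N)"
    by (simp only: norm_mult powr_mult sum_distrib_left[symmetric] times_divide_eq_right)
  then show ?thesis
    using 1(2) unfolding 1(1) lp_norm_ereal by (simp only: powr_mult powr_powr) simp
next
  case 2
  have "mono (\<lambda>t. cmod c * t)" by (auto intro!: monoI mult_left_mono)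
  then have "cmod c * Max ((\<lambda>x. cmod (f x)) ` dual) = Max ((\<lambda>t. cmod c * t) ` (\<lambda>x. cmod (f x)) ` dual)"
    using dual_nonempty by (intro mono_Max_commute) auto
  then show ?thesis unfolding 2 lp_norm_infinity by (simp add: image_image norm_mult)
qed

text \<open>This turns the norm of the quadratic term in the sumset identity into a square of a norm
  of exponent \<open>2 * p\<close>.\<close>

lemma lp_norm_double_exponent:
  assumes "1 \<le> p"
  shows "(lp_norm F d (2 * p) f)\<^sup>2 = lp_norm F d p (\<lambda>x. (f x)\<^sup>2)"
  using assms
proof (cases rule: exponent_cases)
  case (1 r)
  have eq: "2 * p = ereal (2 * r)" using 1 by simp
  have "(\<Sum>x\<in>dual. cmod ((f x)\<^sup>2) powr r) = (\<Sum>x\<in>dual. cmod (f x) powr (2 * r))"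
    by (intro sum.cong refl) (simp add: power2_eq_square norm_mult powr_mult flip: powr_add)
  moreover have "(y powr (1 / (2 * r)))\<^sup>2 = y powr (1 / r)" for y
    using 1(2) by (simp add: power2_eq_square flip: powr_add)
  ultimately show ?thesis
    unfolding eq unfolding 1(1) lp_norm_ereal by simp
next
  case 2
  define M where "M = Max ((\<lambda>x. cmod (f x)) ` dual)"
  have M: "cmod (f x) \<le> M" if "x \<in> dual" for x
    using that unfolding M_def by (intro Max_ge) auto
  have "M \<in> (\<lambda>x. cmod (f x)) ` dual"
    unfolding M_def using dual_nonempty by (intro Max_in) auto
  then have "Max ((\<lambda>x. cmod ((f x)\<^sup>2)) ` dual) = M\<^sup>2"
    using M by (intro Max_eqI) (auto simp: norm_power intro!: power_mono)
  then show ?thesis using 2 by (simp add: lp_norm_infinity M_def)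
qed

section \<open>Sidon sets\<close>

lemma sumset_subset: "E \<subseteq> V \<Longrightarrow> sumset F d E \<subseteq> V"
  by (auto simp: sumset_def subset_iff)

lemma sidon_subset: "sidon_set F d E \<Longrightarrow> E \<subseteq> V"
  by (simp add: sidon_set_def)

lemma sidon_finite: "sidon_set F d E \<Longrightarrow> finite E"
  using sidon_subset finite_V by (rule finite_subset)

text \<open>If distinct \<open>x\<close> and \<open>y\<close> had the same double, it would have the
  two representations \<open>(x, x)\<close> and \<open>(y, y)\<close>.\<close>

lemma sidon_inj_double:
  assumes sidon: "sidon_set F d E"
  shows "inj_on (\<lambda>x. vadd F d x x) E"
proof (rule inj_onI, rule ccontr)
  fix x y assume xy: "x \<in> E" "y \<in> E" "vadd F d x x = vadd F d y y" "x \<noteq> y"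
  let ?R = "{(u, v). u \<in> E \<and> v \<in> E \<and> vadd F d u v = vadd F d x x}"
  have "?R \<subseteq> E \<times> E" by auto
  then have "finite ?R" using sidon_finite[OF sidon] finite_subset by blast
  moreover have "{(x, x), (y, y)} \<subseteq> ?R" using xy by auto
  ultimately have "card {(x, x), (y, y)} \<le> card ?R" by (rule card_mono)
  moreover have "card ?R = 1" using sidon xy(1) by (simp add: sidon_set_def rep_count_def)
  ultimately show False using xy(4) by simp
qed

text \<open>Grouped by value, the pairs give each sum the weight \<open>rep_count\<close>, which is
  1 on doubles and 2 elsewhere. Doubling is injective on \<open>E\<close>, so the second sum adds 1
  exactly on the doubles and makes every weight 2.\<close>

lemma sidon_sum:
  fixes h :: "(nat \<Rightarrow> 'a) \<Rightarrow> complex"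
  assumes sidon: "sidon_set F d E"
  shows "(\<Sum>u\<in>E. \<Sum>v\<in>E. h (vadd F d u v)) + (\<Sum>u\<in>E. h (vadd F d u u))
         = 2 * (\<Sum>y\<in>sumset F d E. h y)"
proof -
  let ?add = "\<lambda>(u, v). vadd F d u v"
  let ?D = "(\<lambda>u. vadd F d u u) ` E"
  have fin: "finite E" using sidon by (rule sidon_finite)
  have img: "sumset F d E = ?add ` (E \<times> E)" by (auto simp: sumset_def)
  have fin2: "finite (sumset F d E)" using fin by (simp add: img)
  have "(\<Sum>u\<in>E. \<Sum>v\<in>E. h (vadd F d u v)) = (\<Sum>p\<in>E \<times> E. h (?add p))"
    by (simp add: sum.cartesian_product case_prod_beta)
  also have "\<dots> = (\<Sum>y\<in>sumset F d E. \<Sum>p\<in>{p \<in> E \<times> E. ?add p = y}. h (?add p))"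
    unfolding img using fin by (intro sum.image_gen) auto
  also have "\<dots> = (\<Sum>y\<in>sumset F d E. of_nat (rep_count F d E y) * h y)"
  proof (intro sum.cong refl)
    fix y
    have "{p \<in> E \<times> E. ?add p = y} = {(u, v). u \<in> E \<and> v \<in> E \<and> vadd F d u v = y}" by auto
    then have "rep_count F d E y = card {p \<in> E \<times> E. ?add p = y}"
      by (simp only: rep_count_def)
    moreover have "(\<Sum>p\<in>{p \<in> E \<times> E. ?add p = y}. h (?add p))
        = (\<Sum>p\<in>{p \<in> E \<times> E. ?add p = y}. h y)"
      by (rule sum.cong) auto
    ultimately show "(\<Sum>p\<in>{p \<in> E \<times> E. ?add p = y}. h (?add p)) = of_nat (rep_count F d E y) * h y"
      by (simp only: sum_constant)
  qed
  finally have 1: "(\<Sum>u\<in>E. \<Sum>v\<in>E. h (vadd F d u v))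
      = (\<Sum>y\<in>sumset F d E. of_nat (rep_count F d E y) * h y)" .
  have "(\<Sum>u\<in>E. h (vadd F d u u)) = (\<Sum>y\<in>?D. h y)"
    using sum.reindex[OF sidon_inj_double[OF sidon], of h] by simp
  also have "\<dots> = (\<Sum>y\<in>sumset F d E. if y \<in> ?D then h y else 0)"
  proof -
    have "?D \<subseteq> sumset F d E" by (auto simp: sumset_def)
    then show ?thesis using fin2 by (intro sum.mono_neutral_cong_left) auto
  qed
  finally have 2: "(\<Sum>u\<in>E. h (vadd F d u u)) = (\<Sum>y\<in>sumset F d E. if y \<in> ?D then h y else 0)" .
  show ?thesis
    unfolding 1 2 sum.distrib[symmetric] sum_distrib_left
  proof (intro sum.cong refl)
    fix y assume "y \<in> sumset F d E"
    then obtain u v where uv: "u \<in> E" "v \<in> E" "y = vadd F d u v" by (auto simp: sumset_def)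
    show "of_nat (rep_count F d E y) * h y + (if y \<in> ?D then h y else 0) = 2 * h y"
    proof (cases "y \<in> ?D")
      case True
      then have "rep_count F d E y = 1" using sidon by (auto simp: sidon_set_def)
      then show ?thesis using True by simp
    next
      case False
      then have "u \<noteq> v" using uv by auto
      then have "rep_count F d E y = 2" using sidon uv by (auto simp: sidon_set_def)
      then show ?thesis using False by simp
    qed
  qed
qed

lemma sidon_card:
  assumes "sidon_set F d E"
  shows "(real (card E))\<^sup>2 + real (card E) = 2 * real (card (sumset F d E))"
proof -
  have "complex_of_real ((real (card E))\<^sup>2 + real (card E))
      = complex_of_real (2 * real (card (sumset F d E)))"
    using sidon_sum[OF assms, of "\<lambda>_. 1"] by (simp add: power2_eq_square)
  then show ?thesis using of_real_eq_iff by blast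
qed

lemma card_le_N: "A \<subseteq> V \<Longrightarrow> real (card A) \<le> N"
  unfolding card_V[symmetric] by (simp add: card_mono)

text \<open>Take \<open>h\<close> to be \<open>wave x\<close> in the weighted count: the double sum
  factors into a square, and the wave at \<open>x\<close> of a doubled vector is the wave at the
  doubled frequency. The factor \<open>N\<close> compensates for squaring the normalisation.\<close>

lemma fourier_sumset:
  assumes sidon: "sidon_set F d E" and x: "x \<in> V"
  shows "2 * fourier F d \<chi> (sumset F d E) x
       = of_real N * (fourier F d \<chi> E x)\<^sup>2 + fourier F d \<chi> E (vadd F d x x)"
proof -
  have sub: "\<And>u. u \<in> E \<Longrightarrow> u \<in> V" using sidon_subset[OF sidon] by auto
  have "(\<Sum>u\<in>E. \<Sum>v\<in>E. wave x (vadd F d u v)) = (\<Sum>u\<in>E. wave x u)\<^sup>2"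
    using x sub by (simp add: power2_eq_square sum_product wave_add_right)
  moreover have "(\<Sum>u\<in>E. wave x (vadd F d u u)) = (\<Sum>u\<in>E. wave (vadd F d x x) u)"
    using x sub by (intro sum.cong refl) (simp add: wave_add_right wave_add_left)
  ultimately have key: "2 * (\<Sum>y\<in>sumset F d E. wave x y)
      = (\<Sum>u\<in>E. wave x u)\<^sup>2 + (\<Sum>u\<in>E. wave (vadd F d x x) u)"
    using sidon_sum[OF sidon, of "wave x"] by simp
  have "2 * fourier F d \<chi> (sumset F d E) x = (2 * (\<Sum>y\<in>sumset F d E. wave x y)) / of_real N"
    by (simp only: fourier_eq times_divide_eq_right)
  also have "\<dots> = of_real N * ((\<Sum>u\<in>E. wave x u) / of_real N)\<^sup>2
                 + (\<Sum>u\<in>E. wave (vadd F d x x) u) / of_real N"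
    unfolding key using N_nonzero
    by (simp only: add_divide_distrib power2_eq_square times_divide_times_eq) simp
  finally show ?thesis by (simp only: fourier_eq)
qed

text \<open>Doubling multiplies each coordinate by the nonzero scalar \<open>1 + 1\<close>. It is
  therefore injective and fixes zero, so it permutes the finite set of nonzero frequencies.\<close>

lemma bij_betw_double:
  assumes two: "\<one> \<oplus> \<one> \<noteq> \<zero>"
  shows "bij_betw (\<lambda>x. vadd F d x x) dual dual"
proof -
  have dbl: "a \<oplus> a = (\<one> \<oplus> \<one>) \<otimes> a" if "a \<in> carrier F" for a
    using that by (simp add: l_distr)
  have inj: "inj_on (\<lambda>x. vadd F d x x) V"
  proof (rule inj_onI)
    fix x y assume xy: "x \<in> V" "y \<in> V" "vadd F d x x = vadd F d y y"
    show "x = y"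
    proof (rule V_eqI[OF xy(1,2)])
      fix i assume i: "i < d"
      have c: "x i \<in> carrier F" "y i \<in> carrier F" using xy i V_closed by auto
      have "x i \<oplus> x i = y i \<oplus> y i"
        using fun_cong[OF xy(3), of i] i by (simp add: vadd_def)
      then have "(\<one> \<oplus> \<one>) \<otimes> x i = (\<one> \<oplus> \<one>) \<otimes> y i"
        by (simp only: dbl c)
      then show "x i = y i" using two c m_lcancel[of "\<one> \<oplus> \<one>" "x i" "y i"] by blast
    qed
  qed
  have zero: "vadd F d (vzero F d) (vzero F d) = vzero F d"
    unfolding vadd_def vzero_def by (rule restrict_ext) simp
  have "vadd F d x x \<in> dual" if "x \<in> dual" for x
    using that inj_onD[OF inj, of x "vzero F d"] zero by auto
  then have "(\<lambda>x. vadd F d x x) ` dual \<subseteq> dual" by (rule image_subsetI)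
  moreover have inj': "inj_on (\<lambda>x. vadd F d x x) dual"
    using inj by (rule inj_on_subset) auto
  ultimately show ?thesis
    unfolding bij_betw_def using endo_inj_surj[of dual] by auto
qed

text \<open>In characteristic 2 doubling is not invertible, but there all doubles coincide, so that
  a Sidon set has at most one element and all its nonempty exponential sums have modulus 1.\<close>

lemma lp_norm_fourier_double:
  assumes sidon: "sidon_set F d E"
  shows "lp_norm F d p (\<lambda>x. fourier F d \<chi> E (vadd F d x x)) = lp_norm F d p (fourier F d \<chi> E)"
proof (cases "\<one> \<oplus> \<one> = \<zero>")
  case False
  then show ?thesis by (intro lp_norm_reindex bij_betw_double)
next
  case True
  have dbl: "vadd F d u u = vzero F d" if "u \<in> V" for u
    unfolding vadd_def vzero_def
  proof (rule restrict_ext)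
    fix i assume "i \<in> {..<d}"
    then have "u i \<in> carrier F" using that V_closed by auto
    then show "u i \<oplus> u i = \<zero>" using l_distr[of \<one> \<one> "u i"] True by simp
  qed
  have eq: "u = v" if "u \<in> E" "v \<in> E" for u v
    using inj_onD[OF sidon_inj_double[OF sidon], of u v] dbl that sidon_subset[OF sidon]
    by (metis subsetD)
  show ?thesis
  proof (cases "E = {}")
    case True
    then show ?thesis by (intro lp_norm_cong) (simp add: fourier_eq)
  next
    case False
    then obtain u where "u \<in> E" by blast
    then have "E = {u}" "u \<in> V" using eq sidon_subset[OF sidon] by auto
    then show ?thesis by (intro lp_norm_cong) (simp add: fourier_eq norm_divide)
  qed
qed

section \<open>Norm bounds for the transforms of a set and of its sumset\<close>

lemma exponent_bounds:
  assumes "1 \<le> (p::ereal)"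
  shows "p \<le> 2 * p" "2 \<le> 2 * p"
  using assms by (cases p; simp)+

lemma sumset_norm_upper_aux:
  assumes sidon: "sidon_set F d E" and p: "1 \<le> p"
  shows "2 * lp_norm F d p (fourier F d \<chi> (sumset F d E))
         \<le> N * (lp_norm F d (2 * p) (fourier F d \<chi> E))\<^sup>2 + lp_norm F d p (fourier F d \<chi> E)"
proof -
  have "2 * lp_norm F d p (fourier F d \<chi> (sumset F d E))
      = lp_norm F d p (\<lambda>x. 2 * fourier F d \<chi> (sumset F d E) x)"
    using lp_norm_scale[OF p, of 2] by simp
  also have "\<dots> = lp_norm F d p (\<lambda>x. of_real N * (fourier F d \<chi> E x)\<^sup>2 + fourier F d \<chi> E (vadd F d x x))"
    by (rule lp_norm_cong) (use fourier_sumset[OF sidon] in auto)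
  also have "\<dots> \<le> lp_norm F d p (\<lambda>x. of_real N * (fourier F d \<chi> E x)\<^sup>2)
                 + lp_norm F d p (\<lambda>x. fourier F d \<chi> E (vadd F d x x))"
    by (rule lp_norm_triangle[OF p])
  finally show ?thesis
    unfolding lp_norm_scale[OF p] lp_norm_double_exponent[OF p] lp_norm_fourier_double[OF sidon]
      norm_of_real using N_pos by simp
qed

text \<open>The sumset identity solved for its quadratic term, followed by the triangle
  inequality.\<close>

lemma sumset_norm_lower_aux:
  assumes sidon: "sidon_set F d E" and p: "1 \<le> p"
  shows "N * (lp_norm F d (2 * p) (fourier F d \<chi> E))\<^sup>2
         \<le> 2 * lp_norm F d p (fourier F d \<chi> (sumset F d E)) + lp_norm F d p (fourier F d \<chi> E)"
proof -
  have "N * (lp_norm F d (2 * p) (fourier F d \<chi> E))\<^sup>2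
      = lp_norm F d p (\<lambda>x. of_real N * (fourier F d \<chi> E x)\<^sup>2)"
    unfolding lp_norm_scale[OF p] lp_norm_double_exponent[OF p] norm_of_real using N_pos by simp
  also have "\<dots> = lp_norm F d p
      (\<lambda>x. 2 * fourier F d \<chi> (sumset F d E) x + (- 1) * fourier F d \<chi> E (vadd F d x x))"
    by (rule lp_norm_cong) (use fourier_sumset[OF sidon] in auto)
  also have "\<dots> \<le> lp_norm F d p (\<lambda>x. 2 * fourier F d \<chi> (sumset F d E) x)
                 + lp_norm F d p (\<lambda>x. (- 1) * fourier F d \<chi> E (vadd F d x x))"
    by (rule lp_norm_triangle[OF p])
  finally show ?thesis
    unfolding lp_norm_scale[OF p] lp_norm_fourier_double[OF sidon] by simp
qed

text \<open>Each summand has modulus 1, which bounds the supremum norm, and that norm dominates all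
  the others.\<close>

lemma lp_norm_fourier_le_card:
  assumes A: "A \<subseteq> V" and p: "1 \<le> p"
  shows "lp_norm F d p (fourier F d \<chi> A) \<le> real (card A) / N"
proof -
  have "cmod (fourier F d \<chi> A x) \<le> real (card A) / N" if "x \<in> dual" for x
    unfolding fourier_eq norm_divide norm_of_real using norm_wave_sum_le[of x A] that A N_pos
    by (simp add: divide_right_mono)
  then have "lp_norm F d \<infinity> (fourier F d \<chi> A) \<le> real (card A) / N"
    unfolding lp_norm_infinity using dual_nonempty by (subst Max_le_iff) auto
  then show ?thesis using lp_norm_exponent_mono[OF p, of \<infinity> "fourier F d \<chi> A"] by simp
qed

lemma lp_norm_1: "lp_norm F d 1 f = (\<Sum>x\<in>dual. cmod (f x)) / N"
  unfolding one_ereal_def lp_norm_ereal using N_pos by (simp add: sum_nonneg)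

text \<open>For exponent 2 the right-hand side is \<open>(N * n - n\<^sup>2) / N\<close> by
  Plancherel, with \<open>n\<close> the size of \<open>E\<close>; larger exponents only increase it.
  The cardinality bound for Sidon sets keeps \<open>n\<close> small enough for the subtracted square
  to be harmless.\<close>

lemma lp_norm_fourier_ge:
  assumes sidon: "sidon_set F d E" and "E \<noteq> {}" and p: "1 \<le> p"
  shows "1 / 2 \<le> (N * lp_norm F d (2 * p) (fourier F d \<chi> E))\<^sup>2"
proof -
  define n where "n = real (card E)"
  have E: "E \<subseteq> V" using sidon by (rule sidon_subset)
  have "card E \<noteq> 0" using assms(2) sidon_finite[OF sidon] by simp
  then consider "n = 1" | "2 \<le> n" by (cases "card E = 1") (auto simp: n_def)
  then have "N / 2 \<le> N * n - n\<^sup>2"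
  proof cases
    case 1
    then show ?thesis using N_ge_2 by simp
  next
    case 2
    have "n\<^sup>2 + n \<le> 2 * N"
      using sidon_card[OF sidon] card_le_N[OF sumset_subset[OF E]] by (simp add: n_def)
    \<comment> \<open>The goal reads \<open>n\<^sup>2\<close> \<le> \<open>N * (n - 1 / 2)\<close>,
      which suggests multiplying the cardinality bound by \<open>n - 1 / 2\<close>.\<close>
    then have "(n\<^sup>2 + n) * (n - 1 / 2) \<le> 2 * N * (n - 1 / 2)"
      using 2 by (intro mult_right_mono) auto
    moreover have "2 * n\<^sup>2 \<le> (n\<^sup>2 + n) * (n - 1 / 2)"
    proof -
      have "0 \<le> n * ((n - 2) * (n + 1 / 2) + 1 / 2)"
        using 2 by (intro mult_nonneg_nonneg add_nonneg_nonneg) auto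
      also have "\<dots> = (n\<^sup>2 + n) * (n - 1 / 2) - 2 * n\<^sup>2"
        by (simp add: field_simps power2_eq_square)
      finally show ?thesis by simp
    qed
    ultimately show ?thesis by (simp add: algebra_simps)
  qed
  then have "1 / 2 \<le> (N * n - n\<^sup>2) / N" using N_pos by (simp add: field_simps)
  also have "\<dots> = N\<^sup>2 * lp_norm F d 1 (\<lambda>x. (fourier F d \<chi> E x)\<^sup>2)"
  proof -
    have "(\<Sum>x\<in>dual. cmod ((fourier F d \<chi> E x)\<^sup>2)) = (\<Sum>x\<in>dual. (cmod (\<Sum>y\<in>E. wave x y))\<^sup>2) / N\<^sup>2"
      unfolding fourier_eq norm_power norm_divide norm_of_real power_divide power2_abs
      by (simp only: sum_divide_distrib)
    then show ?thesis
      unfolding lp_norm_1 Plancherel_dual[OF E] n_def[symmetric] using N_nonzero by simp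
  qed
  also have "\<dots> = (N * lp_norm F d 2 (fourier F d \<chi> E))\<^sup>2"
    using lp_norm_double_exponent[of 1 "fourier F d \<chi> E"] by (simp add: power_mult_distrib)
  also have "\<dots> \<le> (N * lp_norm F d (2 * p) (fourier F d \<chi> E))\<^sup>2"
    using N_pos exponent_bounds[OF p]
    by (intro power_mono mult_left_mono lp_norm_exponent_mono mult_nonneg_nonneg lp_norm_nonneg) auto
  finally show ?thesis .
qed

lemma lp_norm_fourier_le_square:
  assumes sidon: "sidon_set F d E" and p: "1 \<le> p"
  defines "a \<equiv> lp_norm F d (2 * p) (fourier F d \<chi> E)"
  shows "lp_norm F d p (fourier F d \<chi> E) \<le> a" "a \<le> 2 * (N * a\<^sup>2)"
proof -
  have p2: "1 \<le> 2 * p" using exponent_bounds[OF p] p by (meson order_trans)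
  have a0: "0 \<le> a" unfolding a_def using p2 by (rule lp_norm_nonneg)
  show "lp_norm F d p (fourier F d \<chi> E) \<le> a"
    unfolding a_def using exponent_bounds[OF p] by (intro lp_norm_exponent_mono p)
  show "a \<le> 2 * (N * a\<^sup>2)"
  proof (cases "E = {}")
    case True
    then have "a \<le> 0" unfolding a_def using lp_norm_fourier_le_card[OF _ p2, of E] by simp
    then show ?thesis using a0 by simp
  next
    case False
    \<comment> \<open>Weakening 1/2 to 1/4 avoids a square root and leads to the constant 2.\<close>
    have "(1 / 2)\<^sup>2 \<le> (N * a)\<^sup>2"
      using lp_norm_fourier_ge[OF sidon False p] by (simp add: a_def power2_eq_square)
    then have "1 / 2 \<le> N * a"
      by (rule power2_le_imp_le) (intro mult_nonneg_nonneg a0 less_imp_le[OF N_pos])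
    then have "1 / 2 * a \<le> N * a * a" using a0 by (intro mult_right_mono) auto
    then show ?thesis by (simp add: power2_eq_square)
  qed
qed

text \<open>With \<open>M\<close> the size of \<open>A\<close>, each exponential sum is at most
  \<open>M\<close>, so \<open>M\<close> times their absolute sum dominates their sum of squares
  \<open>M * (N - M)\<close>. Hence the absolute sum is at least \<open>N - M\<close>, which yields
  the bound for exponent 1 and thus for every \<open>p\<close>.\<close>

lemma lp_norm_fourier_lower:
  assumes A: "A \<subseteq> V" "A \<noteq> {}" and c: "real (card A) \<le> c * N" and p: "1 \<le> p"
  shows "(1 - c) / N \<le> lp_norm F d p (fourier F d \<chi> A)"
proof -
  define M where "M = real (card A)"
  define S where "S = (\<Sum>x\<in>dual. cmod (\<Sum>y\<in>A. wave x y))"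
  have "finite A" using A(1) finite_V by (rule finite_subset)
  then have M: "0 < M" using A by (simp add: M_def card_gt_0_iff)
  have le: "cmod (\<Sum>y\<in>A. wave x y) \<le> M" if "x \<in> dual" for x
    using norm_wave_sum_le[of x A] that A by (simp add: M_def)
  have "N * M - M\<^sup>2 = (\<Sum>x\<in>dual. (cmod (\<Sum>y\<in>A. wave x y))\<^sup>2)"
    using Plancherel_dual[OF A(1)] by (simp add: M_def)
  also have "\<dots> \<le> (\<Sum>x\<in>dual. M * cmod (\<Sum>y\<in>A. wave x y))"
    unfolding power2_eq_square by (intro sum_mono mult_right_mono le) auto
  also have "\<dots> = M * S" by (simp add: S_def sum_distrib_left)
  finally have "M * (N - M) \<le> M * S" by (simp add: algebra_simps power2_eq_square)
  then have "N - M \<le> S" using M by simp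
  then have "(1 - c) * N \<le> S" using c by (simp add: M_def algebra_simps)
  \<comment> \<open>One division by \<open>N\<close> belongs to the transform, the other to the
    norm.\<close>
  then have "(1 - c) / N \<le> S / N / N"
    using N_pos by (simp only: pos_le_divide_eq divide_right_mono times_divide_eq_left) simp
  also have "S / N / N = lp_norm F d 1 (fourier F d \<chi> A)"
    unfolding lp_norm_1 S_def fourier_eq norm_divide norm_of_real using N_pos
    by (simp add: sum_divide_distrib)
  also have "\<dots> \<le> lp_norm F d p (fourier F d \<chi> A)"
    using p by (intro lp_norm_exponent_mono) auto
  finally show ?thesis .
qed

section \<open>The upper and lower estimates for the sumset\<close>

lemma sumset_norm_lower:
  assumes sidon: "sidon_set F d E" and p: "1 \<le> p"
  shows "1 / 2 * N * (lp_norm F d (2 * p) (fourier F d \<chi> E))\<^sup>2 - real (card E) / N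
         \<le> lp_norm F d p (fourier F d \<chi> (sumset F d E))"
proof -
  \<comment> \<open>Halving the auxiliary bound leaves the error \<open>card E / (2 * N)\<close>;
    nonnegativity allows the full \<open>card E / N\<close>.\<close>
  have "0 \<le> real (card E) / N" using N_pos by simp
  then show ?thesis
    using sumset_norm_lower_aux[OF sidon p] lp_norm_fourier_le_card[OF sidon_subset[OF sidon] p]
    by linarith
qed

lemma sumset_norm_upper:
  assumes sidon: "sidon_set F d E" and p: "1 \<le> p"
  shows "lp_norm F d p (fourier F d \<chi> (sumset F d E))
         \<le> 2 * (N * (lp_norm F d (2 * p) (fourier F d \<chi> E))\<^sup>2)"
proof -
  \<comment> \<open>The auxiliary bounds give the constant 3/2, rounded up to 2 here.\<close>
  have "0 \<le> N * (lp_norm F d (2 * p) (fourier F d \<chi> E))\<^sup>2" using N_pos by simp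
  then show ?thesis
    using sumset_norm_upper_aux[OF sidon p] lp_norm_fourier_le_square[OF sidon p] by linarith
qed

lemma sumset_norm_lower_dense:
  assumes sidon: "sidon_set F d E" and p: "1 \<le> p" and c: "0 < c" "c < 1"
    and card: "real (card (sumset F d E)) \<le> c * N"
  shows "N * (lp_norm F d (2 * p) (fourier F d \<chi> E))\<^sup>2
         \<le> 4 / (1 - c) * lp_norm F d p (fourier F d \<chi> (sumset F d E))"
proof -
  define a where "a = lp_norm F d (2 * p) (fourier F d \<chi> E)"
  define T where "T = lp_norm F d p (fourier F d \<chi> (sumset F d E))"
  have p2: "1 \<le> 2 * p" using exponent_bounds[OF p] p by (meson order_trans)
  have a0: "0 \<le> a" unfolding a_def using p2 by (rule lp_norm_nonneg)
  have T0: "0 \<le> T" unfolding T_def using p by (rule lp_norm_nonneg)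
  have E: "E \<subseteq> V" using sidon by (rule sidon_subset)
  have "N * a\<^sup>2 \<le> 4 / (1 - c) * T"
  proof (cases "E = {}")
    case True
    then have "a \<le> 0" unfolding a_def using lp_norm_fourier_le_card[OF _ p2, of E] by simp
    then show ?thesis using a0 T0 c by simp
  next
    case False
    show ?thesis
    \<comment> \<open>From 2 onwards, \<open>a\<close> is at most half of
      \<open>N * a\<^sup>2\<close> and can be absorbed, giving the constant 4. Below 2, the quantity
      is at most \<open>4 / N\<close> and is compared with the lower bound
      \<open>(1 - c) / N\<close>. Both fit under \<open>4 / (1 - c)\<close>.\<close>
    proof (cases "2 \<le> N * a")
      case True
      have "N * a\<^sup>2 \<le> 2 * T + a"
        unfolding a_def T_def
        using sumset_norm_lower_aux[OF sidon p] lp_norm_fourier_le_square(1)[OF sidon p] by linarith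
      moreover have "2 * a \<le> N * a\<^sup>2"
        using mult_right_mono[OF True a0] by (simp add: power2_eq_square)
      ultimately have "N * a\<^sup>2 \<le> 4 * T" by linarith
      also have "\<dots> \<le> 4 / (1 - c) * T" using c T0 by (intro mult_right_mono) (auto simp: field_simps)
      finally show ?thesis .
    next
      case small: False
      have ne: "sumset F d E \<noteq> {}" using False by (auto simp: sumset_def)
      have "(N * a)\<^sup>2 \<le> 2\<^sup>2" using small a0 N_pos by (intro power_mono) auto
      then have "N * a\<^sup>2 \<le> 4 / N" using N_pos by (simp add: field_simps power2_eq_square)
      also have "\<dots> = 4 / (1 - c) * ((1 - c) / N)"
      proof -
        have "4 / (1 - c) * (1 - c) = 4" using c by (simp add: field_simps)
        then show ?thesis by (simp only: times_divide_eq_right)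
      qed
      also have "\<dots> \<le> 4 / (1 - c) * T"
        unfolding T_def using lp_norm_fourier_lower[OF sumset_subset[OF E] ne card p] c
        by (intro mult_left_mono) auto
      finally show ?thesis .
    qed
  qed
  then show ?thesis by (simp add: a_def T_def)
qed

end

theorem theorem7p1:
  shows
   "(\<forall>(F :: 'a ring) d \<chi> E (p :: ereal).
       finite_field_setting F d \<chi> \<and> sidon_set F d E \<and> 1 \<le> p \<longrightarrow>
         1 / 2 * real (card (carrier F)) ^ d * (lp_norm F d (2 * p) (fourier F d \<chi> E))\<^sup>2
           - real (card E) / real (card (carrier F)) ^ d
         \<le> lp_norm F d p (fourier F d \<chi> (sumset F d E)))
  \<and> (\<exists>C>0. \<forall>(F :: 'a ring) d \<chi> E (p :: ereal).
       finite_field_setting F d \<chi> \<and> sidon_set F d E \<and> 1 \<le> p \<longrightarrow>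
         lp_norm F d p (fourier F d \<chi> (sumset F d E))
         \<le> C * (real (card (carrier F)) ^ d * (lp_norm F d (2 * p) (fourier F d \<chi> E))\<^sup>2))
  \<and> (\<forall>c::real. 0 < c \<and> c < 1 \<longrightarrow>
       (\<exists>C\<^sub>1>0. \<exists>C\<^sub>2>0. \<forall>(F :: 'a ring) d \<chi> E (p :: ereal).
         finite_field_setting F d \<chi> \<and> sidon_set F d E \<and> 1 \<le> p
         \<and> real (card (sumset F d E)) \<le> c * real (card (carrier F)) ^ d \<longrightarrow>
           lp_norm F d p (fourier F d \<chi> (sumset F d E))
             \<le> C\<^sub>1 * (real (card (carrier F)) ^ d * (lp_norm F d (2 * p) (fourier F d \<chi> E))\<^sup>2)
         \<and> real (card (carrier F)) ^ d * (lp_norm F d (2 * p) (fourier F d \<chi> E))\<^sup>2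
             \<le> C\<^sub>2 * lp_norm F d p (fourier F d \<chi> (sumset F d E))))"
proof (intro conjI allI impI)
  fix F :: "'a ring" and d \<chi> E and p :: ereal
  assume asm: "finite_field_setting F d \<chi> \<and> sidon_set F d E \<and> 1 \<le> p"
  then interpret finite_field_fourier F d \<chi> by unfold_locales simp
  show "1 / 2 * real (card (carrier F)) ^ d * (lp_norm F d (2 * p) (fourier F d \<chi> E))\<^sup>2
           - real (card E) / real (card (carrier F)) ^ d
         \<le> lp_norm F d p (fourier F d \<chi> (sumset F d E))"
    using asm by (intro sumset_norm_lower) auto
next
  \<comment> \<open>The constant 2 serves for \<open>C\<close> and for \<open>C\<^sub>1\<close>, as
    it is fixed before the field, the dimension, the set and the exponent.\<close>
  have upper: "lp_norm F d p (fourier F d \<chi> (sumset F d E))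
         \<le> 2 * (real (card (carrier F)) ^ d * (lp_norm F d (2 * p) (fourier F d \<chi> E))\<^sup>2)"
    if "finite_field_setting F d \<chi>" "sidon_set F d E" "1 \<le> p"
    for F :: "'a ring" and d \<chi> E and p :: ereal
    using that by (intro finite_field_fourier.sumset_norm_upper finite_field_fourier.intro)
  then show "\<exists>C>0. \<forall>(F :: 'a ring) d \<chi> E (p :: ereal).
       finite_field_setting F d \<chi> \<and> sidon_set F d E \<and> 1 \<le> p \<longrightarrow>
         lp_norm F d p (fourier F d \<chi> (sumset F d E))
         \<le> C * (real (card (carrier F)) ^ d * (lp_norm F d (2 * p) (fourier F d \<chi> E))\<^sup>2)"
    by (intro exI[of _ 2]) auto
  fix c :: real
  assume c: "0 < c \<and> c < 1"
  have lower: "real (card (carrier F)) ^ d * (lp_norm F d (2 * p) (fourier F d \<chi> E))\<^sup>2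
             \<le> 4 / (1 - c) * lp_norm F d p (fourier F d \<chi> (sumset F d E))"
    if "finite_field_setting F d \<chi>" "sidon_set F d E" "1 \<le> p"
      "real (card (sumset F d E)) \<le> c * real (card (carrier F)) ^ d"
    for F :: "'a ring" and d \<chi> E and p :: ereal
    using that c by (intro finite_field_fourier.sumset_norm_lower_dense finite_field_fourier.intro) auto
  show "\<exists>C\<^sub>1>0. \<exists>C\<^sub>2>0. \<forall>(F :: 'a ring) d \<chi> E (p :: ereal).
         finite_field_setting F d \<chi> \<and> sidon_set F d E \<and> 1 \<le> p
         \<and> real (card (sumset F d E)) \<le> c * real (card (carrier F)) ^ d \<longrightarrow>
           lp_norm F d p (fourier F d \<chi> (sumset F d E))
             \<le> C\<^sub>1 * (real (card (carrier F)) ^ d * (lp_norm F d (2 * p) (fourier F d \<chi> E))\<^sup>2)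
         \<and> real (card (carrier F)) ^ d * (lp_norm F d (2 * p) (fourier F d \<chi> E))\<^sup>2
             \<le> C\<^sub>2 * lp_norm F d p (fourier F d \<chi> (sumset F d E))"
    \<comment> \<open>The second witness \<open>4 / (1 - c)\<close> depends on \<open>c\<close>
      alone and is positive since \<open>c\<close> is below 1.\<close>
    by (rule exI[of _ 2], rule conjI, simp, rule exI[of _ "4 / (1 - c)"])
       (use c upper lower in simp)
qed

end
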